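(* In terms of the tangent and secant numbers of order $k$, $T(n,k)$ and $S(n,k)$, for every integer $n\ge 0$ and every real $x$ at which the function being differentiated is defined (and, in (b), (d) and elsewhere, all functions appearing are then defined), we have: (a) $\displaystyle\frac{d^{n}}{dx^{n}}\tan(x)= T(n,1)+\sum_{k=1}^{n+1}\frac{1}{k}\,T(n+1,k)\tan^k(x)$; (b) $\displaystyle\frac{d^{n}}{dx^{n}}\sec(x)= \sec(x)\sum_{k=0}^{n} S(n,k)\tan^k(x)$; (c) $\displaystyle\frac{d^{n}}{dx^{n}}\cot(x)= (-1)^n\left[T(n,1) +\sum_{k=1}^{n+1} \frac{1}{k}\,T(n+1,k)\cot^k(x)\right]$; (d) $\displaystyle\frac{d^{n}}{dx^{n}}\csc(x)= (-1)^n\csc(x)\sum_{k=0}^{n} S(n,k)\cot^k(x)$.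
   Context: The tangent numbers of order $k$, $T(n,k)$, are defined for integers $k\ge 1$ by the power series expansion at $t=0$ $$\tan^{k}(t)=\sum_{n = k}^{\infty} T(n,k)\,\frac{t^n}{n!},$$ and the secant numbers of order $k$, $S(n,k)$, are defined for integers $k\ge 0$ by $$\sec(t) \tan^{k}(t)=\sum_{n = k}^{\infty} S(n,k)\,\frac{t^n}{n!}.$$ By convention $T(n,k)=0$ and $S(n,k)=0$ for $0\le n<k$ (in particular $T(0,1)=0$). The functions $\tan,\sec$ are defined where $\cos x\neq 0$, and $\cot=\cos/\sin$, $\csc=1/\sin$ where $\sin x\neq 0$. *)

theory Defs
  imports "HOL-Analysis.Analysis"
begin

unbundle fps_syntax

definition sec :: "real \<Rightarrow> real" where
  "sec x = 1 / cos x"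

definition csc :: "real \<Rightarrow> real" where
  "csc x = 1 / sin x"

text \<open>
  The tangent and secant numbers of order \<open>k\<close> are read off from formal power series; the
  lemmas below confirm that these are the power series expansions at \<open>0\<close> of the real functions
  \<open>tan\<^sup>k\<close> and \<open>sec tan\<^sup>k\<close>. Tangent numbers are only meant to be used for \<open>k \<ge> 1\<close>.
\<close>

definition tangent_number :: "nat \<Rightarrow> nat \<Rightarrow> real" where
  "tangent_number n k = fact n * (fps_tan 1 ^ k) $ n"

definition secant_number :: "nat \<Rightarrow> nat \<Rightarrow> real" where
  "secant_number n k = fact n * (inverse (fps_cos 1) * fps_tan 1 ^ k) $ n"

lemma tan_power_has_fps_expansion:
  "(\<lambda>t::real. tan t ^ k) has_fps_expansion fps_tan 1 ^ k"
proof (induction k)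
  case (Suc k)
  show ?case
    using has_fps_expansion_mult[OF has_fps_expansion_tan' Suc] by simp
qed simp

lemma tangent_number_expansion:
  "(\<lambda>t::real. tan t ^ k) has_fps_expansion Abs_fps (\<lambda>n. tangent_number n k / fact n)"
proof -
  have "Abs_fps (\<lambda>n. tangent_number n k / fact n) = fps_tan 1 ^ k"
    by (simp add: tangent_number_def fps_eq_iff)
  then show ?thesis
    using tan_power_has_fps_expansion by simp
qed

lemma secant_number_expansion:
  "(\<lambda>t. sec t * tan t ^ k) has_fps_expansion Abs_fps (\<lambda>n. secant_number n k / fact n)"
proof -
  have "Abs_fps (\<lambda>n. secant_number n k / fact n) = inverse (fps_cos 1) * fps_tan 1 ^ k"
    by (simp add: secant_number_def fps_eq_iff)
  moreover have "sec has_fps_expansion inverse (fps_cos 1)"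
    using has_fps_expansion_inverse[OF has_fps_expansion_cos', where 'a = real]
    by (simp add: sec_def[abs_def] inverse_eq_divide)
  ultimately show ?thesis
    using has_fps_expansion_mult[OF _ tan_power_has_fps_expansion] by simp
qed

lemma fps_tan_nth_0: "fps_tan (1::real) $ 0 = 0"
  by (simp add: fps_tan_def fps_divide_unit)

lemma tangent_number_eq_0: "n < k \<Longrightarrow> tangent_number n k = 0"
  by (simp add: tangent_number_def startsby_zero_power_prefix fps_tan_nth_0)

lemma secant_number_eq_0: "n < k \<Longrightarrow> secant_number n k = 0"
  by (auto simp: secant_number_def fps_mult_nth startsby_zero_power_prefix fps_tan_nth_0
      intro!: sum.neutral)

end

theory Submission
  imports Defs
begin

text \<open>
  Let \<open>u\<close> and \<open>w\<close> satisfy \<open>u' = e (1 + u\<^sup>2)\<close> and \<open>w' = e s u w\<close> for constants \<open>e\<close> and \<open>s\<close>. Then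
  differentiation maps \<open>w p(u)\<close>, with \<open>p\<close> a polynomial, to \<open>e w q(u)\<close> with
  \<open>q(y) = s y p(y) + (1 + y\<^sup>2) p'(y)\<close>, and on coefficients \<open>p \<mapsto> q\<close> reads
  \<open>q\<^sub>k = (s + k - 1) p\<^sub>k\<^sub>-\<^sub>1 + (k + 1) p\<^sub>k\<^sub>+\<^sub>1\<close>. So the \<open>n\<close>-th derivative of \<open>w p(u)\<close> is \<open>e\<^sup>n\<close> times \<open>w\<close>
  times a polynomial in \<open>u\<close> whose coefficients are found by iterating this recurrence
  (\<open>iterated_deriv_weighted_polynomial\<close>).

  The pairs \<open>(tan, sec)\<close> with \<open>e = 1\<close> and \<open>(cot, csc)\<close> with \<open>e = -1\<close> solve the equations for \<open>s = 1\<close>,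
  and \<open>w = 1\<close> solves the second one for \<open>s = 0\<close>. Hence all four formulas follow once the coefficients
  in them are seen to satisfy the recurrence, with \<open>s = 0\<close> for the tangent numbers and \<open>s = 1\<close>
  for the secant numbers. That is the same computation again, made at \<open>0\<close> with power series: comparing
  coefficients in \<open>(tan\<^sup>k\<^sup>+\<^sup>1)' = (k+1) (tan\<^sup>k + tan\<^sup>k\<^sup>+\<^sup>2)\<close> and in
  \<open>(sec tan\<^sup>k\<^sup>+\<^sup>1)' = (k+1) sec tan\<^sup>k + (k+2) sec tan\<^sup>k\<^sup>+\<^sup>2\<close> gives \<open>tangent_number_Suc\<close> and
  \<open>secant_number_Suc\<close>.
\<close>

section \<open>Recurrences for tangent and secant numbers\<close>

lemma fps_deriv_tan: "fps_deriv (fps_tan (1::real)) = 1 + fps_tan 1 ^ 2"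
proof -
  have c0: "fps_cos (1::real) $ 0 \<noteq> 0" by simp
  have t: "fps_tan (1::real) = fps_sin 1 * inverse (fps_cos 1)"
    by (simp add: fps_tan_def fps_divide_unit c0)
  have i: "fps_cos (1::real) * inverse (fps_cos 1) = 1"
    using inverse_mult_eq_1'[OF c0] .
  have "fps_deriv (fps_tan (1::real)) = (inverse (fps_cos 1))\<^sup>2"
    by (simp add: fps_tan_deriv fps_divide_unit c0 fps_inverse_power)
  also have "\<dots> = ((fps_cos 1)\<^sup>2 + (fps_sin 1)\<^sup>2) * (inverse (fps_cos (1::real)))\<^sup>2"
    by (simp add: fps_sin_cos_sum_of_squares)
  also have "\<dots> = (fps_cos 1 * inverse (fps_cos 1))\<^sup>2 + (fps_tan (1::real))\<^sup>2"
    by (simp add: t algebra_simps power2_eq_square)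
  finally show ?thesis by (simp add: i)
qed

lemma fps_deriv_sec:
  "fps_deriv (inverse (fps_cos (1::real))) = inverse (fps_cos 1) * fps_tan 1"
  by (simp add: fps_inverse_deriv fps_cos_deriv fps_tan_def fps_divide_unit 
      power2_eq_square algebra_simps flip: fps_const_neg)

lemma fps_deriv_tan_power:
  "fps_deriv (fps_tan (1::real) ^ Suc k) = of_nat (Suc k) * (fps_tan 1 ^ k + fps_tan 1 ^ (k + 2))"
  unfolding fps_deriv_power' fps_deriv_tan
  by (simp add: algebra_simps power2_eq_square del: of_nat_Suc)

lemma tangent_number_0_right: "tangent_number n 0 = (if n = 0 then 1 else 0)"
  by (simp add: tangent_number_def)

lemma fact_mult_fps_deriv_nth: "fact (Suc n) * f $ Suc n = fact n * fps_deriv (f :: real fps) $ n"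
  by simp

lemma fps_of_nat_mult_nth: "(of_nat a * f :: real fps) $ n = of_nat a * f $ n"
  by (metis fps_mult_left_const_nth fps_of_nat)

lemma tangent_number_Suc:
  "tangent_number (Suc n) (Suc k) = real (Suc k) * (tangent_number n k + tangent_number n (k + 2))"
  unfolding tangent_number_def fact_mult_fps_deriv_nth fps_deriv_tan_power fps_of_nat_mult_nth
  by (simp add: algebra_simps)

lemma secant_number_Suc_0: "secant_number (Suc n) 0 = secant_number n 1"
  unfolding secant_number_def fact_mult_fps_deriv_nth by (simp add: fps_deriv_sec)

lemma secant_number_Suc:
  "secant_number (Suc n) (Suc k) =
     real (Suc k) * secant_number n k + real (k + 2) * secant_number n (k + 2)"
proof -
  let ?s = "inverse (fps_cos (1::real))" and ?t = "fps_tan (1::real)"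
  have "fps_deriv (?s * ?t ^ Suc k) =
      of_nat (Suc k) * (?s * ?t ^ k) + of_nat (k + 2) * (?s * ?t ^ (k + 2))"
    unfolding fps_deriv_mult fps_deriv_tan_power fps_deriv_sec by (simp add: algebra_simps)
  then show ?thesis
    unfolding secant_number_def fact_mult_fps_deriv_nth
    by (simp only: fps_add_nth fps_of_nat_mult_nth) (simp add: algebra_simps)
qed

text \<open>
  The coefficient of \<open>u\<^sup>k\<close> in the polynomial for the tangent and the cotangent. The constant term has
  to be given separately, since dividing \<open>T(n+1,k)\<close> by \<open>k\<close> makes no sense there; \<open>T(n,1)\<close> is the value
  that makes the recurrence hold at \<open>k = 0\<close> as well.
\<close>

definition tan_deriv_coeff :: "nat \<Rightarrow> nat \<Rightarrow> real" where
  "tan_deriv_coeff n k =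
     (if k = 0 then tangent_number n 1 else 1 / real k * tangent_number (Suc n) k)"

lemma tan_deriv_coeff_Suc_0: "tan_deriv_coeff (Suc n) 0 = tan_deriv_coeff n 1"
  by (simp add: tan_deriv_coeff_def)

text \<open>
  Dividing \<open>tangent_number_Suc\<close> by \<open>k + 1\<close> leaves \<open>T(n+1,k) + T(n+1,k+2)\<close>, and the division by \<open>k\<close> in
  the coefficients turns these two terms into the multiples \<open>k\<close> and \<open>k + 2\<close> of the previous
  coefficients. At \<open>k = 0\<close> this is consistent because \<open>T(n+1,0) = 0\<close>.
\<close>

lemma tan_deriv_coeff_Suc:
  "tan_deriv_coeff (Suc n) (Suc k) =
     real k * tan_deriv_coeff n k + real (k + 2) * tan_deriv_coeff n (k + 2)"
proof -
  have "tan_deriv_coeff (Suc n) (Suc k) = tangent_number (Suc n) k + tangent_number (Suc n) (k + 2)"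
    by (simp add: tan_deriv_coeff_def tangent_number_Suc[of "Suc n"] del: of_nat_Suc)
  then show ?thesis
    by (auto simp: tan_deriv_coeff_def tangent_number_0_right)
qed

lemma tan_deriv_coeff_eq_0: "n + 1 < k \<Longrightarrow> tan_deriv_coeff n k = 0"
  by (simp add: tan_deriv_coeff_def tangent_number_eq_0)

lemma sum_tan_deriv_coeff:
  "(\<Sum>k\<le>n+1. tan_deriv_coeff n k * y ^ k) =
     tangent_number n 1 + (\<Sum>k=1..n+1. 1 / real k * tangent_number (n + 1) k * y ^ k)"
proof -
  have "{..n+1} = insert 0 {1..n+1}" by auto
  then show ?thesis by (simp add: tan_deriv_coeff_def)
qed

section \<open>Iterated derivatives of weighted polynomials\<close>

text \<open>
  The operator \<open>p \<mapsto> s y p + (1 + y\<^sup>2) p'\<close> applied to \<open>p = \<Sum> c\<^sub>k y\<^sup>k\<close>, term by term on the left and sorted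
  by powers of \<open>y\<close> on the right.
\<close>

lemma sum_coeff_shift:
  fixes c c' :: "nat \<Rightarrow> real" and s y :: real
  assumes c0: "c' 0 = c 1"
    and cS: "\<And>k. c' (Suc k) = (s + real k) * c k + real (k + 2) * c (k + 2)"
    and vanish: "\<And>k. N < k \<Longrightarrow> c k = 0"
  shows "(\<Sum>k\<le>N. c k * (s * y ^ Suc k + real k * y ^ (k - 1) * (1 + y\<^sup>2))) =
         (\<Sum>k\<le>Suc N. c' k * y ^ k)"
proof -
  have "(\<Sum>k\<le>N. c k * (s * y ^ Suc k + real k * y ^ (k - 1) * (1 + y\<^sup>2))) =
      (\<Sum>k\<le>N. (s + real k) * c k * y ^ Suc k) + (\<Sum>k\<le>N. real k * c k * y ^ (k - 1))"
    unfolding sum.distrib[symmetric]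
  proof (rule sum.cong[OF refl])
    fix k
    show "c k * (s * y ^ Suc k + real k * y ^ (k - 1) * (1 + y\<^sup>2)) =
        (s + real k) * c k * y ^ Suc k + real k * c k * y ^ (k - 1)"
      by (cases k) (simp_all add: algebra_simps power2_eq_square)
  qed
  \<comment> \<open>Two vanishing terms are appended so that dropping the first two terms gives the range
    of the other sum.\<close>
  also have "(\<Sum>k\<le>N. real k * c k * y ^ (k - 1)) = (\<Sum>k\<le>Suc (Suc N). real k * c k * y ^ (k - 1))"
    using vanish by simp
  also have "\<dots> = c 1 + (\<Sum>k\<le>N. real (k + 2) * c (k + 2) * y ^ Suc k)"
    by (simp only: sum.atMost_Suc_shift) simp
  finally show ?thesis
    by (simp only: sum.atMost_Suc_shift c0 cS) (simp add: algebra_simps sum.distrib)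
qed

text \<open>
  Induction on \<open>n\<close>: by \<open>sum_coeff_shift\<close> one differentiation performs one step of the recurrence on the
  coefficients, raises the degree by one and contributes a factor \<open>e\<close>. The formula must be known on
  the whole open set \<open>A\<close>, not only at \<open>x\<close>, to be differentiated again.
\<close>

lemma iterated_deriv_weighted_polynomial:
  fixes f u w :: "real \<Rightarrow> real" and c :: "nat \<Rightarrow> nat \<Rightarrow> real" and e s :: real
  assumes "open A"
    and du: "\<And>x. x \<in> A \<Longrightarrow> (u has_real_derivative e * (1 + (u x)\<^sup>2)) (at x)"
    and dw: "\<And>x. x \<in> A \<Longrightarrow> (w has_real_derivative e * (s * u x * w x)) (at x)"
    and f: "\<And>x. x \<in> A \<Longrightarrow> f x = w x * (\<Sum>k\<le>d. c 0 k * u x ^ k)"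
    and c0: "\<And>n. c (Suc n) 0 = c n 1"
    and cS: "\<And>n k. c (Suc n) (Suc k) = (s + real k) * c n k + real (k + 2) * c n (k + 2)"
    and vanish: "\<And>n k. n + d < k \<Longrightarrow> c n k = 0"
    and "x \<in> A"
  shows "(deriv ^^ n) f x = e ^ n * (w x * (\<Sum>k\<le>n+d. c n k * u x ^ k))"
    and "(deriv ^^ n) f differentiable (at x)"
proof -
  define g where "g n x = e ^ n * (w x * (\<Sum>k\<le>n+d. c n k * u x ^ k))" for n x
  have dg: "(g n has_real_derivative g (Suc n) x) (at x)" if "x \<in> A" for n x
  proof -
    have "(g n has_real_derivative e ^ n * (e * (s * u x * w x) * (\<Sum>k\<le>n+d. c n k * u x ^ k) +
        w x * (\<Sum>k\<le>n+d. c n k * (real k * (u x ^ (k - 1) * (e * (1 + (u x)\<^sup>2))))))) (at x)"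
      unfolding g_def by (auto intro!: derivative_eq_intros du dw that simp: algebra_simps)
    also have "e ^ n * (e * (s * u x * w x) * (\<Sum>k\<le>n+d. c n k * u x ^ k) +
        w x * (\<Sum>k\<le>n+d. c n k * (real k * (u x ^ (k - 1) * (e * (1 + (u x)\<^sup>2)))))) =
        e ^ Suc n * (w x * (\<Sum>k\<le>n+d. c n k * (s * u x ^ Suc k + real k * u x ^ (k - 1) * (1 + (u x)\<^sup>2))))"
      by (simp add: sum_distrib_left sum.distrib algebra_simps)
    also have "\<dots> = g (Suc n) x"
      using sum_coeff_shift[of "c (Suc n)" "c n" s "n + d" "u x"] c0 cS vanish
      by (simp add: g_def)
    finally show ?thesis .
  qed
  have eq: "\<forall>x\<in>A. (deriv ^^ n) f x = g n x" for n
  proof (induction n)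
    case 0
    then show ?case by (simp add: g_def f)
  next
    case (Suc n)
    have "((deriv ^^ n) f has_real_derivative g (Suc n) x) (at x)" if "x \<in> A" for x
      using has_field_derivative_transform_within_open[OF dg[OF that] \<open>open A\<close> that] Suc by auto
    then show ?case by (auto intro: DERIV_imp_deriv)
  qed
  from eq \<open>x \<in> A\<close> show "(deriv ^^ n) f x = e ^ n * (w x * (\<Sum>k\<le>n+d. c n k * u x ^ k))"
    by (simp add: g_def)
  have "((deriv ^^ n) f has_real_derivative g (Suc n) x) (at x)"
    using has_field_derivative_transform_within_open[OF dg[OF \<open>x \<in> A\<close>] \<open>open A\<close> \<open>x \<in> A\<close>] eq by auto
  then show "(deriv ^^ n) f differentiable (at x)"
    using real_differentiable_def by blast
qed

section \<open>The two families of functions\<close>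

text \<open>The case \<open>w = 1\<close>, \<open>s = 0\<close>, started from the polynomial \<open>p(y) = y\<close> of degree \<open>1\<close>.\<close>

lemma iterated_deriv_tangent_like:
  fixes u :: "real \<Rightarrow> real"
  assumes "open A" and "\<And>x. x \<in> A \<Longrightarrow> (u has_real_derivative e * (1 + (u x)\<^sup>2)) (at x)" and "x \<in> A"
  shows "(deriv ^^ n) u x = e ^ n *
      (tangent_number n 1 + (\<Sum>k=1..n+1. 1 / real k * tangent_number (n + 1) k * u x ^ k))"
    and "(deriv ^^ n) u differentiable (at x)"
proof -
  have init: "u x = 1 * (\<Sum>k\<le>1. tan_deriv_coeff 0 k * u x ^ k)" for x
    by (simp add: tan_deriv_coeff_def tangent_number_eq_0 tangent_number_Suc[of 0 0, simplified]
        tangent_number_0_right)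
  note * = iterated_deriv_weighted_polynomial[where w = "\<lambda>_. 1" and s = 0 and f = u and u = u
      and c = tan_deriv_coeff and d = 1, OF assms(1,2) _ init tan_deriv_coeff_Suc_0 _
      tan_deriv_coeff_eq_0 assms(3)]
  show "(deriv ^^ n) u x = e ^ n *
      (tangent_number n 1 + (\<Sum>k=1..n+1. 1 / real k * tangent_number (n + 1) k * u x ^ k))"
    unfolding sum_tan_deriv_coeff[symmetric]
    by (subst *) (simp_all add: tan_deriv_coeff_Suc)
  show "(deriv ^^ n) u differentiable (at x)"
    by (rule *) (simp_all add: tan_deriv_coeff_Suc)
qed

text \<open>The case \<open>s = 1\<close>, started from the constant polynomial \<open>p(y) = 1\<close>.\<close>

lemma iterated_deriv_secant_like:
  fixes u w :: "real \<Rightarrow> real"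
  assumes "open A" and "\<And>x. x \<in> A \<Longrightarrow> (u has_real_derivative e * (1 + (u x)\<^sup>2)) (at x)"
    and dw: "\<And>x. x \<in> A \<Longrightarrow> (w has_real_derivative e * (u x * w x)) (at x)" and "x \<in> A"
  shows "(deriv ^^ n) w x = e ^ n * (w x * (\<Sum>k=0..n. secant_number n k * u x ^ k))"
    and "(deriv ^^ n) w differentiable (at x)"
proof -
  have init: "w x = w x * (\<Sum>k\<le>0. secant_number 0 k * u x ^ k)" for x
    by (simp add: secant_number_def)
  have vanish: "secant_number n k = 0" if "n + 0 < k" for n k
    using that by (simp add: secant_number_eq_0)
  note * = iterated_deriv_weighted_polynomial[where w = w and s = 1 and f = w and u = u
      and c = secant_number and d = 0, OF assms(1,2) _ init secant_number_Suc_0 _ vanish assms(4)]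
  show "(deriv ^^ n) w x = e ^ n * (w x * (\<Sum>k=0..n. secant_number n k * u x ^ k))"
    by (subst *) (simp_all add: secant_number_Suc dw atLeast0AtMost)
  show "(deriv ^^ n) w differentiable (at x)"
    by (rule *) (simp_all add: secant_number_Suc dw)
qed

theorem corollary1:
  fixes n :: nat and x :: real
  shows
    "(cos x \<noteq> 0 \<longrightarrow>
        (\<forall>m<n. (deriv ^^ m) tan differentiable (at x)) \<and>
        (deriv ^^ n) tan x =
          tangent_number n 1 +
          (\<Sum>k=1..n+1. 1 / real k * tangent_number (n + 1) k * tan x ^ k)) \<and>
     (cos x \<noteq> 0 \<longrightarrow>
        (\<forall>m<n. (deriv ^^ m) sec differentiable (at x)) \<and>
        (deriv ^^ n) sec x = sec x * (\<Sum>k=0..n. secant_number n k * tan x ^ k)) \<and>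
     (sin x \<noteq> 0 \<longrightarrow>
        (\<forall>m<n. (deriv ^^ m) cot differentiable (at x)) \<and>
        (deriv ^^ n) cot x =
          (-1) ^ n * (tangent_number n 1 +
          (\<Sum>k=1..n+1. 1 / real k * tangent_number (n + 1) k * cot x ^ k))) \<and>
     (sin x \<noteq> 0 \<longrightarrow>
        (\<forall>m<n. (deriv ^^ m) csc differentiable (at x)) \<and>
        (deriv ^^ n) csc x = (-1) ^ n * csc x * (\<Sum>k=0..n. secant_number n k * cot x ^ k))"
proof -
  have openC: "open {x::real. cos x \<noteq> 0}" and openS: "open {x::real. sin x \<noteq> 0}"
    by (intro open_Collect_neq continuous_intros)+
  have dtan: "(tan has_real_derivative 1 * (1 + (tan x)\<^sup>2)) (at x)" if "x \<in> {x. cos x \<noteq> 0}" for x :: real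
    using that DERIV_tan[of x] by (simp add: tan_sec[of x] add.commute inverse_eq_divide power_one_over)
  have dsec: "(sec has_real_derivative 1 * (tan x * sec x)) (at x)" if "x \<in> {x. cos x \<noteq> 0}" for x
    using that unfolding sec_def[abs_def]
    by (auto intro!: derivative_eq_intros simp: tan_def field_simps)
  have dcot: "(cot has_real_derivative - 1 * (1 + (cot x)\<^sup>2)) (at x)" if "x \<in> {x. sin x \<noteq> 0}" for x :: real
  proof -
    from that have "inverse ((sin x)\<^sup>2) = 1 + (cot x)\<^sup>2"
      using sin_cos_squared_add[of x] by (simp add: cot_def field_simps)
    with that DERIV_cot[of x] show ?thesis by simp
  qed
  have dcsc: "(csc has_real_derivative - 1 * (cot x * csc x)) (at x)" if "x \<in> {x. sin x \<noteq> 0}" for x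
    using that unfolding csc_def[abs_def]
    by (auto intro!: derivative_eq_intros simp: cot_def field_simps)
  show ?thesis
    using iterated_deriv_tangent_like[OF openC dtan] iterated_deriv_secant_like[OF openC dtan dsec]
      iterated_deriv_tangent_like[OF openS dcot] iterated_deriv_secant_like[OF openS dcot dcsc]
    by (simp add: mult.assoc)
qed

end
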